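(* The following are equivalent: (1) VG: $\delta(V_n,V)\to0$ as $n\to\infty$. (2) The projectors $P_n$ are ANCO. (3) There exist ANCO.
   Context: Setting. $O$ is an infinite dimensional separable real Hilbert space with scalar product $\langle\cdot,\cdot\rangle$ and norm $|\cdot|$. $X\subseteq O$ is a dense subspace, itself a Hilbert space with continuous inclusion $X\to O$. $a$ is a continuous symmetric bilinear form on $X$ with $a(u,u)\ge 0$ for all $u\in X$, such that $\langle\cdot,\cdot\rangle+a$ is coercive on $X$; this form is taken as the scalar product of $X$, so $\|u\|^2=|u|^2+a(u,u)$ is the norm of $X$. Define $W=\{u\in X: a(u,u')=0\ \forall u'\in X\}$ and $V=\{u\in X:\langle u,w\rangle=0\ \forall w\in W\}$, so $X=V\oplus W$. $W$ may be infinite dimensional. It is assumed that the injection $V\to O$ is compact ($V$ carrying the norm of $X$). Discretization. $(X_n)_{n\in\mathbb N}$ is a sequence of finite dimensional subspaces of $X$ satisfying AS: for all $u\in X$, $\lim_{n\to\infty}\inf_{u'\in X_n}\|u-u'\|=0$. Define $W_n=\{u\in X_n: a(u,u')=0\ \forall u'\in X_n\}=X_n\cap W$ and $V_n=\{u\in X_n:\langle u,w\rangle=0\ \forall w\in W_n\}$, so $X_n=V_n\oplus W_n$ ($V_n$ need not be contained in $V$). $P_n:X\to V_n$ is defined by: $P_nu\in V_n$ and $a(P_nu,v)=a(u,v)$ for all $v\in V_n$. Gap. For subspaces $U,U'$ of $X$, $\delta(U,U')=\sup_{u\in U, u\neq0}\inf_{u'\in U'}\|u-u'\|/\|u\|$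 (supremum over the empty set being $0$). Compatible operators. A linear operator $Q_n:X\to X_n$ is compatible with $X_n$ if it maps $W$ into $W_n$ and $u-Q_nu\in W_n$ for every $u\in X_n$. A sequence $(Q_n)$ is compatible if each $Q_n$ is compatible with $X_n$. ANCO (Aubin-Nitsche Compatible Operators) are compatible sequences $(Q_n)$ such that $\|\mathrm{id}-Q_n\|_{V\to O}\to0$, i.e. for some sequence $\epsilon_n\to0$: $|v-Q_nv|\le\epsilon_n\|v\|$ for all $v\in V$ and all $n$. *)

theory Defs
  imports "HOL-Analysis.Analysis"
begin

(* The space X is a type 'x, and its inclusion into the ambient Hilbert space 'o is an
   explicit injective map \<iota>, so that "norm u" is the norm of X and "norm (\<iota> u)" is the
   norm of the ambient space. Subspaces of X are sets of type 'x set.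

   With U = UNIV the next two definitions give W and V; with U = X_n they give W_n and V_n. *)

definition form_kernel :: "('x \<Rightarrow> 'x \<Rightarrow> real) \<Rightarrow> 'x set \<Rightarrow> 'x set" where
  "form_kernel a U = {u \<in> U. \<forall>u' \<in> U. a u u' = 0}"

definition kernel_complement ::
  "('x \<Rightarrow> 'o::real_inner) \<Rightarrow> ('x \<Rightarrow> 'x \<Rightarrow> real) \<Rightarrow> 'x set \<Rightarrow> 'x set" where
  "kernel_complement \<iota> a U = {u \<in> U. \<forall>w \<in> form_kernel a U. inner (\<iota> u) (\<iota> w) = 0}"

definition compact_map_on ::
  "'x::real_normed_vector set \<Rightarrow> ('x \<Rightarrow> 'o::real_normed_vector) \<Rightarrow> bool" where
  "compact_map_on S T \<longleftrightarrow> (\<forall>B \<subseteq> S. bounded B \<longrightarrow> compact (closure (T ` B)))"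

definition finite_dimensional :: "'a::real_vector set \<Rightarrow> bool" where
  "finite_dimensional S \<longleftrightarrow> (\<exists>B. finite B \<and> S \<subseteq> span B)"

(* For subspaces U, U' the quotients lie in [0, 1] because 0 is in U', so the real
   supremum is the genuine one; over the empty set it is 0 by convention. *)
definition gap :: "'x::real_normed_vector set \<Rightarrow> 'x set \<Rightarrow> real" where
  "gap U U' =
     (if U \<subseteq> {0} then 0
      else (SUP u \<in> U - {0}. (INF u' \<in> U'. norm (u - u') / norm u)))"

(* The vector p exists and is unique when S is a finite-dimensional subspace and a is a
   symmetric positive semidefinite form: a is then positive definite on the complement. *)
definition form_projector ::
  "('x \<Rightarrow> 'o::real_inner) \<Rightarrow> ('x \<Rightarrow> 'x \<Rightarrow> real) \<Rightarrow> 'x set \<Rightarrow> 'x \<Rightarrow> 'x" where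
  "form_projector \<iota> a S u =
     (THE p. p \<in> kernel_complement \<iota> a S \<and> (\<forall>v \<in> kernel_complement \<iota> a S. a p v = a u v))"

definition compatible_operator ::
  "('x::real_vector \<Rightarrow> 'x \<Rightarrow> real) \<Rightarrow> 'x set \<Rightarrow> ('x \<Rightarrow> 'x) \<Rightarrow> bool" where
  "compatible_operator a S Q \<longleftrightarrow>
     linear Q \<and> range Q \<subseteq> S \<and> Q ` form_kernel a UNIV \<subseteq> form_kernel a S \<and>
     (\<forall>u \<in> S. u - Q u \<in> form_kernel a S)"

definition ANCO ::
  "('x::real_normed_vector \<Rightarrow> 'o::real_inner) \<Rightarrow> ('x \<Rightarrow> 'x \<Rightarrow> real) \<Rightarrow>
   (nat \<Rightarrow> 'x set) \<Rightarrow> (nat \<Rightarrow> 'x \<Rightarrow> 'x) \<Rightarrow> bool" where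
  "ANCO \<iota> a Xn Q \<longleftrightarrow>
     (\<forall>n. compatible_operator a (Xn n) (Q n)) \<and>
     (\<exists>\<epsilon>. \<epsilon> \<longlonglongrightarrow> 0 \<and>
        (\<forall>n. \<forall>v \<in> kernel_complement \<iota> a UNIV. norm (\<iota> v - \<iota> (Q n v)) \<le> \<epsilon> n * norm v))"

end

(* Everything is expressed by the X-orthogonal splitting x = v + w along V and W.
   For u in V_n the distance to V is the norm of the W-part of u, so VG says that the W-parts
   of bounded sequences u_n in V_n tend to 0. Given ANCO Q_n, and u = v + w in V_n, the vector
   u - Q_n v lies in W_n and is orthogonal to w, hence |w| <= |v - Q_n v|: this is VG.
   Conversely, under VG put e_n = v_n - P_n v_n for bounded v_n in V. The W-part of e_n is that
   of -P_n v_n. Its V-part x_n satisfies a(x_n, u) = a(e_n, u - u_n) for all u_n in X_n, so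
   a(x_n, u) tends to 0 by AS; the compactness of V -> O then gives |x_n| -> 0. *)
theory Submission
  imports Defs
begin

section \<open>Positive semidefinite forms and orthogonal projections\<close>

text \<open>The quadratic t -> a(u + t v, u + t v) is nonnegative. Since \<open>a\<close> may be
  degenerate, the case \<open>a v v = 0\<close> is separate: the polynomial is then affine, so its
  slope must vanish.\<close>

lemma psd_form_Cauchy_Schwarz:
  fixes a :: "'x::real_normed_vector \<Rightarrow> 'x \<Rightarrow> real"
  assumes bil: "bounded_bilinear a" and sym: "\<And>u v. a u v = a v u" and psd: "\<And>u. a u u \<ge> 0"
  shows "(a u v)\<^sup>2 \<le> a u u * a v v"
proof -
  interpret bounded_bilinear a by (rule bil)
  have expand: "a u u + 2 * t * a u v + t\<^sup>2 * a v v \<ge> 0" for t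
  proof -
    have "a (u + t *\<^sub>R v) (u + t *\<^sub>R v) = a u u + 2 * t * a u v + t\<^sup>2 * a v v"
      by (simp add: add_left add_right scaleR_left scaleR_right sym[of v u] power2_eq_square
          algebra_simps)
    then show ?thesis using psd[of "u + t *\<^sub>R v"] by simp
  qed
  show ?thesis
  proof (cases "a v v = 0")
    case True
    have "a u v = 0"
    proof (rule ccontr)
      assume "a u v \<noteq> 0"
      \<comment> \<open>At this t the affine function would take the value -1.\<close>
      then show False
        using expand[of "- (a u u + 1) / (2 * a u v)"] psd[of u] True by (simp add: field_simps)
    qed
    then show ?thesis by (simp add: True)
  next
    case False
    then have "a v v > 0" using psd[of v] by simp
    then show ?thesis
      using expand[of "- a u v / a v v"] by (simp add: field_simps power2_eq_square)
  qed
qed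

text \<open>Gram-Schmidt for a possibly degenerate form: \<open>c\<close> is the part of
  \<open>b\<close> that is \<open>a\<close>-orthogonal to \<open>span B\<close>, and the projection
  is corrected along \<open>c\<close>. It serves both for the form and for the scalar product of
  X.\<close>

lemma psd_form_projection_exists:
  fixes a :: "'x::real_normed_vector \<Rightarrow> 'x \<Rightarrow> real"
  assumes bil: "bounded_bilinear a" and sym: "\<And>u v. a u v = a v u" and psd: "\<And>u. a u u \<ge> 0"
    and "finite B"
  shows "\<exists>P. bounded_linear P \<and> (\<forall>u. P u \<in> span B \<and> (\<forall>v\<in>span B. a (P u) v = a u v))"
  using \<open>finite B\<close>
proof (induction B)
  case empty
  interpret bounded_bilinear a by (rule bil)
  show ?case
    by (intro exI[of _ "\<lambda>_. 0"]) (simp add: bounded_linear_zero zero_right)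
next
  case (insert b B)
  interpret bounded_bilinear a by (rule bil)
  obtain P where P: "bounded_linear P" "\<And>u. P u \<in> span B"
    "\<And>u v. v \<in> span B \<Longrightarrow> a (P u) v = a u v"
    using insert.IH by blast
  define c where "c = b - P b"
  \<comment> \<open>If \<open>a c c = 0\<close>, the quotient is 0 by convention. This is the right
    coefficient, because Cauchy-Schwarz then forces \<open>a u c = 0\<close>.\<close>
  define R where "R u = P u + (a u c / a c c) *\<^sub>R c" for u
  have c_orth: "a c v = 0" if "v \<in> span B" for v
    using P(3)[OF that, of b] by (simp add: c_def diff_left)
  have c_orth': "a v c = 0" if "v \<in> span B" for v
    using c_orth[OF that] sym by simp
  have PB: "P u \<in> span (insert b B)" for u
    using P(2)[of u] span_mono[of B "insert b B"] by blast
  have c_in: "c \<in> span (insert b B)"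
    unfolding c_def by (intro span_diff PB span_base) simp
  have "bounded_linear R"
    unfolding R_def
    by (intro bounded_linear_add P(1) bounded_linear_scaleR_left[THEN bounded_linear_compose]
        bounded_linear_divide[THEN bounded_linear_compose] bounded_linear_left)
  moreover have "R u \<in> span (insert b B)" for u
    unfolding R_def by (intro span_add span_scale PB c_in)
  moreover have "a (R u) v = a u v" if v: "v \<in> span (insert b B)" for u v
  proof -
    obtain k where k: "v - k *\<^sub>R b \<in> span B"
      using v span_breakdown_eq by blast
    define y where "y = v - k *\<^sub>R b + k *\<^sub>R P b"
    have y: "y \<in> span B" unfolding y_def by (intro span_add k span_scale P(2))
    have v_eq: "v = y + k *\<^sub>R c" by (simp add: y_def c_def algebra_simps)
    have Rc: "a (R u) c = a u c"
    proof (cases "a c c = 0")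
      case True
      have "a u c = 0"
        using psd_form_Cauchy_Schwarz[OF bil sym psd, of u c] True by simp
      then show ?thesis
        using c_orth'[OF P(2), of u] by (simp add: R_def True add_left scaleR_left)
    next
      case False
      then show ?thesis
        using c_orth'[OF P(2), of u] by (simp add: R_def add_left scaleR_left)
    qed
    have Ry: "a (R u) y = a u y"
      using c_orth[OF y] P(3)[OF y] by (simp add: R_def add_left scaleR_left)
    show ?thesis by (simp add: v_eq add_right scaleR_right Rc Ry)
  qed
  ultimately show ?case by blast
qed

lemma finite_dimensional_subspace_eq_span:
  assumes "subspace S" "finite_dimensional S"
  obtains B where "finite B" "S = span B"
proof -
  obtain D where D: "finite D" "S \<subseteq> span D"
    using assms(2) by (auto simp: finite_dimensional_def)
  obtain B where B: "B \<subseteq> S" "independent B" "S \<subseteq> span B"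
    using maximal_independent_subset[of S] by metis
  have "finite B"
    using independent_span_bound[OF D(1) B(2)] B(1) D(2) by blast
  moreover have "S = span B"
    using B assms(1) by (meson span_minimal subset_antisym)
  ultimately show ?thesis using that by blast
qed

section \<open>Orthogonal projection and Riesz representation in Hilbert space\<close>

text \<open>A minimizing sequence for the distance from \<open>x\<close> to \<open>S\<close> is
  Cauchy by the parallelogram law. Its limit is a nearest point, and minimality along the lines
  through it in \<open>S\<close> is orthogonality.\<close>

lemma closed_subspace_projection_exists:
  fixes S :: "'x::{real_inner, complete_space} set"
  assumes sub: "subspace S" and "closed S"
  shows "\<exists>p\<in>S. \<forall>s\<in>S. inner (x - p) s = 0"
proof -
  define d where "d = (INF s\<in>S. norm (x - s))"
  have ne: "S \<noteq> {}" using subspace_0[OF sub] by blast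
  have bdd: "bdd_below ((\<lambda>s. norm (x - s)) ` S)" by (rule bdd_belowI2[of _ 0]) simp
  have d_le: "d \<le> norm (x - s)" if "s \<in> S" for s
    unfolding d_def by (rule cINF_lower[OF bdd that])
  have d0: "d \<ge> 0" unfolding d_def by (rule cINF_greatest[OF ne]) simp
  have "\<exists>s\<in>S. norm (x - s) < d + 1 / real (Suc n)" for n
  proof -
    have "d < d + 1 / real (Suc n)" by simp
    then show ?thesis unfolding d_def using cINF_less_iff[OF ne bdd] by blast
  qed
  then obtain s where s: "\<And>n. s n \<in> S" "\<And>n. norm (x - s n) < d + 1 / real (Suc n)"
    by metis
  have lim: "(\<lambda>n. norm (x - s n)) \<longlonglongrightarrow> d"
  proof (rule tendsto_sandwich[of "\<lambda>_. d" _ _ "\<lambda>n. d + 1 / real (Suc n)"])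
    show "(\<lambda>n. d + 1 / real (Suc n)) \<longlonglongrightarrow> d"
      using tendsto_add[OF tendsto_const[of d] LIMSEQ_inverse_real_of_nat]
      by (simp add: inverse_eq_divide)
  qed (simp_all only: d_le[OF s(1)] less_imp_le[OF s(2)] eventually_True tendsto_const)
  have lim2: "(\<lambda>n. (norm (x - s n))\<^sup>2) \<longlonglongrightarrow> d\<^sup>2" by (intro tendsto_power lim)
  \<comment> \<open>Parallelogram law: the midpoint of \<open>s m\<close> and \<open>s n\<close>
    lies in \<open>S\<close>, hence at distance at least \<open>d\<close> from
    \<open>x\<close>.\<close>
  have para: "(norm (s m - s n))\<^sup>2 \<le> 2 * (norm (x - s m))\<^sup>2 + 2 * (norm (x - s n))\<^sup>2 - 4 * d\<^sup>2"
    for m n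
  proof -
    have "(1/2) *\<^sub>R (s m + s n) \<in> S"
      by (intro subspace_scale subspace_add sub s(1))
    then have "d\<^sup>2 \<le> (norm (x - (1/2) *\<^sub>R (s m + s n)))\<^sup>2"
      using d_le d0 by (intro power_mono)
    then show ?thesis
      unfolding power2_norm_eq_inner
      by (simp add: inner_diff_left inner_diff_right inner_add_left inner_add_right
          inner_commute[of "s n" "s m"] inner_commute[of "s m" x] inner_commute[of "s n" x]
          field_simps)
  qed
  have "Cauchy s"
  proof (rule CauchyI)
    fix e :: real assume "0 < e"
    then have "\<forall>\<^sub>F n in sequentially. (norm (x - s n))\<^sup>2 < d\<^sup>2 + e\<^sup>2 / 4"
      by (intro order_tendstoD(2)[OF lim2]) simp
    then obtain N where N: "\<And>n. n \<ge> N \<Longrightarrow> (norm (x - s n))\<^sup>2 < d\<^sup>2 + e\<^sup>2 / 4"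
      by (auto simp: eventually_sequentially)
    have "norm (s m - s n) < e" if "m \<ge> N" "n \<ge> N" for m n
    proof -
      have "(norm (s m - s n))\<^sup>2 < e\<^sup>2"
        using para[of m n] N[OF that(1)] N[OF that(2)] by simp
      then show ?thesis using \<open>0 < e\<close> by (intro power_less_imp_less_base[of _ 2 e]) auto
    qed
    then show "\<exists>M. \<forall>m\<ge>M. \<forall>n\<ge>M. norm (s m - s n) < e" by blast
  qed
  then obtain p where p: "s \<longlonglongrightarrow> p" using Cauchy_convergent_iff convergent_def by blast
  have pS: "p \<in> S" using closed_sequentially[OF \<open>closed S\<close> _ p] s(1) by blast
  have np: "norm (x - p) = d"
    using LIMSEQ_unique[OF tendsto_norm[OF tendsto_diff[OF tendsto_const p]] lim] .
  have "inner (x - p) u = 0" if u: "u \<in> S" for u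
  proof (cases "u = 0")
    case False
    \<comment> \<open>The minimiser of the quadratic in t: a nonzero scalar product would bring
      \<open>p + t *\<^sub>R u\<close> closer to \<open>x\<close> than \<open>d\<close>.\<close>
    define t where "t = inner (x - p) u / inner u u"
    have "p + t *\<^sub>R u \<in> S" by (intro subspace_add subspace_scale sub pS u)
    then have "(norm (x - p))\<^sup>2 \<le> (norm (x - (p + t *\<^sub>R u)))\<^sup>2"
      using d_le d0 np by (intro power_mono) auto
    also have "\<dots> = (norm (x - p))\<^sup>2 - 2 * t * inner (x - p) u + t\<^sup>2 * inner u u"
      unfolding power2_norm_eq_inner
      by (simp add: inner_diff_left inner_diff_right inner_add_left inner_add_right
          inner_commute[of p x] inner_commute[of u x] inner_commute[of u p] power2_eq_square
          algebra_simps)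
    also have "\<dots> = (norm (x - p))\<^sup>2 - (inner (x - p) u)\<^sup>2 / inner u u"
      using False by (simp add: t_def power2_eq_square)
    finally have "(inner (x - p) u)\<^sup>2 / inner u u \<le> 0" by simp
    then have "(inner (x - p) u)\<^sup>2 \<le> 0" using False by (simp add: pos_divide_le_eq)
    then show ?thesis by simp
  qed simp
  then show ?thesis using pS by blast
qed

text \<open>The kernel of a nonzero functional has codimension one, so a vector orthogonal to it
  represents the functional after scaling.\<close>

lemma Riesz_representation_exists:
  fixes f :: "'x::{real_inner, complete_space} \<Rightarrow> real"
  assumes "bounded_linear f"
  shows "\<exists>r. \<forall>x. f x = inner r x"
proof (cases "\<forall>x. f x = 0")
  case True
  then show ?thesis by (intro exI[of _ 0]) simp
next
  case False
  interpret bounded_linear f by (rule assms)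
  let ?K = "{x. f x = 0}"
  obtain x where x: "f x \<noteq> 0" using False by blast
  have "subspace ?K" by (auto simp: subspace_def zero add scale)
  moreover have "closed ?K"
    by (intro closed_Collect_eq linear_continuous_on assms continuous_intros)
  ultimately obtain p where p: "f p = 0" "\<And>s. f s = 0 \<Longrightarrow> inner (x - p) s = 0"
    using closed_subspace_projection_exists[of ?K x] by auto
  define z where "z = x - p"
  have fz: "f z \<noteq> 0" using x p(1) by (simp add: z_def diff)
  then have z: "z \<noteq> 0" using zero by auto
  have "f y = inner ((f z / inner z z) *\<^sub>R z) y" for y
  proof -
    have "f (y - (f y / f z) *\<^sub>R z) = 0" using fz by (simp add: diff scale)
    then have "inner z (y - (f y / f z) *\<^sub>R z) = 0" using p(2) by (simp add: z_def)
    then show ?thesis using fz z by (simp add: inner_diff_right field_simps)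
  qed
  then show ?thesis by blast
qed

text \<open>Near-maximisers reduce uniform convergence on the unit ball to convergence along a
  single sequence. The operator norms will later serve as the \<open>\<epsilon>\<close> of
  \<open>ANCO\<close>.\<close>

lemma onorm_tendsto_0:
  fixes T :: "nat \<Rightarrow> 'x::real_normed_vector \<Rightarrow> 'y::real_normed_vector"
  assumes bl: "\<And>n. bounded_linear (T n)"
    and null: "\<And>x. (\<And>n. norm (x n) \<le> 1) \<Longrightarrow> (\<lambda>n. T n (x n)) \<longlonglongrightarrow> 0"
  shows "(\<lambda>n. onorm (T n)) \<longlonglongrightarrow> 0"
proof -
  \<comment> \<open>The norm need not be attained, hence the factor 2: without such an
    \<open>x\<close>, half the operator norm would already bound \<open>T n\<close>.\<close>
  have "\<exists>x. norm x \<le> 1 \<and> onorm (T n) \<le> 2 * norm (T n x)" for n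
  proof (rule ccontr)
    assume "\<nexists>x. norm x \<le> 1 \<and> onorm (T n) \<le> 2 * norm (T n x)"
    then have less: "2 * norm (T n x) < onorm (T n)" if "norm x \<le> 1" for x
      using that by (meson not_le)
    interpret bounded_linear "T n" by (rule bl)
    have pos: "0 < onorm (T n)" using less[of 0] by (simp add: zero)
    have "norm (T n x) \<le> onorm (T n) / 2 * norm x" for x
    proof (cases "x = 0")
      case False
      then show ?thesis
        using less[of "(1 / norm x) *\<^sub>R x"] by (simp add: scale field_simps)
    qed (simp add: zero)
    then have "onorm (T n) \<le> onorm (T n) / 2" using pos by (intro onorm_bound) auto
    then show False using pos by simp
  qed
  then obtain x where x: "\<And>n. norm (x n) \<le> 1" "\<And>n. onorm (T n) \<le> 2 * norm (T n (x n))"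
    by metis
  have "(\<lambda>n. 2 * norm (T n (x n))) \<longlonglongrightarrow> 0"
    using tendsto_mult_left[OF tendsto_norm_zero[OF null[OF x(1)]], of 2] by simp
  then show ?thesis
    by (rule tendsto_sandwich[rotated 2, OF tendsto_const])
      (auto simp: x(2) onorm_pos_le[OF bl])
qed

section \<open>The splitting along the kernel of the form\<close>

locale form_space =
  fixes \<iota> :: "'x::{real_inner, complete_space} \<Rightarrow> 'o::real_inner"
    and a :: "'x \<Rightarrow> 'x \<Rightarrow> real"
  assumes bl: "bounded_linear \<iota>" and bil: "bounded_bilinear a"
    and sym: "a u v = a v u" and psd: "a u u \<ge> 0"
    and inner_eq: "inner u v = inner (\<iota> u) (\<iota> v) + a u v"
begin

sublocale iota: bounded_linear \<iota> by (rule bl)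
sublocale form: bounded_bilinear a by (rule bil)

abbreviation "W \<equiv> form_kernel a UNIV"
abbreviation "V \<equiv> kernel_complement \<iota> a UNIV"

lemmas Cauchy_Schwarz = psd_form_Cauchy_Schwarz[OF bil sym psd]

text \<open>Cauchy-Schwarz upgrades a(u,u) = 0 to a(u,x) = 0 for every x of X. This is the identity
  W_n = X_n \<inter> W.\<close>

lemma form_kernel_iff: "u \<in> form_kernel a U \<longleftrightarrow> u \<in> U \<and> (\<forall>x. a u x = 0)"
proof -
  have "a u x = 0" if "a u u = 0" for x
    using Cauchy_Schwarz[of u x] that by simp
  then show ?thesis by (auto simp: form_kernel_def)
qed

lemma subspace_form_kernel: "subspace U \<Longrightarrow> subspace (form_kernel a U)"
  by (auto simp: subspace_def form_kernel_iff form.zero_left form.add_left form.scaleR_left)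

text \<open>Since \<open>a\<close> vanishes against the kernel, orthogonality to it means the same
  in the ambient space and in X. From here on V and V_n are orthogonal complements for the scalar
  product of X.\<close>

lemma kernel_complement_iff:
  "u \<in> kernel_complement \<iota> a U \<longleftrightarrow> u \<in> U \<and> (\<forall>w\<in>form_kernel a U. inner u w = 0)"
  by (auto simp: kernel_complement_def inner_eq form_kernel_iff sym)

lemma norm_sq: "(norm u)\<^sup>2 = (norm (\<iota> u))\<^sup>2 + a u u"
  by (simp add: power2_norm_eq_inner inner_eq)

lemma norm_iota_kernel: "w \<in> form_kernel a U \<Longrightarrow> norm (\<iota> w) = norm w"
  using norm_sq[of w] by (simp add: form_kernel_iff)

definition wpart :: "'x \<Rightarrow> 'x" where
  "wpart x = (SOME w. w \<in> W \<and> (\<forall>s\<in>W. inner (x - w) s = 0))"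

definition vpart :: "'x \<Rightarrow> 'x" where
  "vpart x = x - wpart x"

text \<open>W is closed, being the intersection of the kernels of the bounded functionals x ->
  a(x,y), so the orthogonal projection onto it exists.\<close>

lemma wpart: "wpart x \<in> W" and vpart: "vpart x \<in> V"
proof -
  have "W = (\<Inter>y. {x. a x y = 0})" by (auto simp: form_kernel_iff)
  moreover have "closed {x. a x y = 0}" for y
    by (intro closed_Collect_eq linear_continuous_on form.bounded_linear_left continuous_intros)
  ultimately have "closed W" by auto
  then have "\<exists>w. w \<in> W \<and> (\<forall>s\<in>W. inner (x - w) s = 0)"
    using closed_subspace_projection_exists[OF subspace_form_kernel[OF subspace_UNIV]] by blast
  then have "wpart x \<in> W \<and> (\<forall>s\<in>W. inner (x - wpart x) s = 0)"
    unfolding wpart_def by (rule someI_ex)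
  then show "wpart x \<in> W" "vpart x \<in> V" by (auto simp: kernel_complement_iff vpart_def)
qed

lemma split: "vpart x + wpart x = x" by (simp add: vpart_def)

lemma form_vpart: "a (vpart x) u = a x u"
  using wpart[of x] by (simp add: vpart_def form.diff_left form_kernel_iff)

lemma form_vpart_vpart: "a (vpart u) (vpart u) = a u u"
  using form_vpart[of u u] form_vpart[of u "vpart u"] sym[of u "vpart u"] by simp

lemma V_W_orth: "v \<in> V \<Longrightarrow> w \<in> W \<Longrightarrow> inner v w = 0"
  by (simp add: kernel_complement_iff)

lemma V_Int_W: "v \<in> V \<Longrightarrow> v \<in> W \<Longrightarrow> v = 0"
  using V_W_orth[of v v] by simp

lemma subspace_V: "subspace V"
  by (auto simp: subspace_def kernel_complement_iff inner_add_left)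

lemma vpart_add:
  assumes "v \<in> V" "w \<in> W"
  shows "vpart (v + w) = v"
proof -
  have "v - vpart (v + w) = wpart (v + w) - w"
    using split[of "v + w"] by (simp add: algebra_simps)
  moreover have "v - vpart (v + w) \<in> V" by (intro subspace_diff subspace_V assms vpart)
  moreover have "wpart (v + w) - w \<in> W"
    by (intro subspace_diff subspace_form_kernel subspace_UNIV assms wpart)
  ultimately have "v - vpart (v + w) = 0" using V_Int_W by metis
  then show ?thesis by simp
qed

lemma vpart_V: "v \<in> V \<Longrightarrow> vpart v = v"
  using vpart_add[of v 0] subspace_0[OF subspace_form_kernel[OF subspace_UNIV]] by simp

lemma Pythagoras:
  assumes "v \<in> V" "w \<in> W"
  shows "(norm (v + w))\<^sup>2 = (norm v)\<^sup>2 + (norm w)\<^sup>2"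
  using V_W_orth[OF assms]
  by (simp add: power2_norm_eq_inner inner_add_left inner_add_right inner_commute)

lemma norm_vpart_le: "norm (vpart x) \<le> norm x"
  using Pythagoras[OF vpart wpart, of x x] split[of x] by (simp add: power2_le_imp_le)

text \<open>Pythagoras applied to x - v = (vpart x - v) + wpart x.\<close>

lemma norm_wpart_le_dist:
  assumes "v \<in> V"
  shows "norm (wpart x) \<le> norm (x - v)"
proof -
  have "x - v = (vpart x - v) + wpart x" using split[of x] by (simp add: algebra_simps)
  moreover have "vpart x - v \<in> V" by (intro subspace_diff subspace_V assms vpart)
  ultimately have "(norm (x - v))\<^sup>2 = (norm (vpart x - v))\<^sup>2 + (norm (wpart x))\<^sup>2"
    using Pythagoras wpart by metis
  then show ?thesis by (simp add: power2_le_imp_le)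
qed

text \<open>The choice made in \<open>wpart\<close> carries no linearity by itself; linearity comes
  from uniqueness of the splitting, \<open>vpart_add\<close>.\<close>

lemma bounded_linear_vpart: "bounded_linear vpart"
proof (rule bounded_linear_intro[where K = 1])
  have W: "subspace W" by (intro subspace_form_kernel subspace_UNIV)
  fix x y r
  have "x + y = (vpart x + vpart y) + (wpart x + wpart y)"
    using split[of x] split[of y] by (simp add: algebra_simps)
  then show "vpart (x + y) = vpart x + vpart y"
    using vpart_add subspace_add[OF subspace_V vpart vpart] subspace_add[OF W wpart wpart]
    by metis
  have "r *\<^sub>R x = r *\<^sub>R vpart x + r *\<^sub>R wpart x"
    using split[of x] by (metis scaleR_add_right)
  then show "vpart (r *\<^sub>R x) = r *\<^sub>R vpart x"
    using vpart_add subspace_scale[OF subspace_V vpart] subspace_scale[OF W wpart]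
    by metis
qed (simp add: norm_vpart_le)

section \<open>The gap\<close>

text \<open>The nearest point of V to \<open>u\<close> is \<open>vpart u\<close>, so the infimum is
  a minimum.\<close>

lemma gap_term_eq: "(INF v\<in>V. norm (u - v) / norm u) = norm (wpart u) / norm u"
proof (rule cInf_eq_minimum)
  show "norm (wpart u) / norm u \<in> (\<lambda>v. norm (u - v) / norm u) ` V"
    using vpart[of u] by (intro image_eqI[of _ _ "vpart u"]) (auto simp: vpart_def)
qed (auto intro!: divide_right_mono norm_wpart_le_dist)

lemma norm_wpart_le_gap:
  assumes "u \<in> U"
  shows "norm (wpart u) \<le> gap U V * norm u"
proof (cases "u = 0")
  case True
  then show ?thesis using norm_wpart_le_dist[of 0 0] subspace_0[OF subspace_V] by simp
next
  case False
  \<comment> \<open>Comparison with the point 0 of V bounds the quotients by 1, so the real supremum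
    really is an upper bound.\<close>
  have "bdd_above ((\<lambda>u. norm (wpart u) / norm u) ` (U - {0}))"
    using norm_wpart_le_dist[OF subspace_0[OF subspace_V]]
    by (intro bdd_aboveI2[of _ _ 1]) (simp add: divide_le_eq_1)
  then have "norm (wpart u) / norm u \<le> gap U V"
    using assms False cSUP_upper[of u "U - {0}" "\<lambda>u. norm (wpart u) / norm u"]
    by (auto simp: gap_def gap_term_eq)
  then show ?thesis using False by (simp add: divide_le_eq)
qed

lemma gap_nonneg: "0 \<le> gap U V"
proof (cases "U \<subseteq> {0}")
  case False
  then obtain u where u: "u \<in> U" "u \<noteq> 0" by blast
  then have "0 \<le> gap U V * norm u" using norm_wpart_le_gap norm_ge_zero order_trans by blast
  then show ?thesis using u(2) by (simp add: zero_le_mult_iff)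
qed (simp add: gap_def)

lemma gap_le:
  assumes "0 \<le> e" "\<And>u. u \<in> U \<Longrightarrow> norm (wpart u) \<le> e * norm u"
  shows "gap U V \<le> e"
proof (cases "U \<subseteq> {0}")
  case False
  then have "(SUP u\<in>U - {0}. norm (wpart u) / norm u) \<le> e"
    using assms(2) by (intro cSUP_least) (auto simp: pos_divide_le_eq)
  then show ?thesis using False by (simp add: gap_def gap_term_eq)
qed (simp add: gap_def assms(1))

section \<open>Compactness\<close>

text \<open>If \<open>\<iota> x\<^sub>n\<close> tends to \<open>f\<close>, and \<open>r\<close> represents the functional \<open>\<langle>f, \<iota> _\<rangle>\<close> in \<open>X\<close>, then passing
  to the limit in \<open>\<langle>r, x\<^sub>n\<rangle> = \<langle>\<iota> r, \<iota> x\<^sub>n\<rangle> + a(r, x\<^sub>n)\<close> gives \<open>|f|\<^sup>2 = \<parallel>r\<parallel>\<^sup>2 = \<langle>\<iota> r, f\<rangle>\<close>.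
  Hence \<open>a(r, r) = 0\<close>, so \<open>r\<close> is in both \<open>V\<close> and \<open>W\<close>.\<close>

lemma weakly_null_imp_null:
  assumes compact: "compact_map_on V \<iota>"
    and V: "\<And>n. x n \<in> V" and bdd: "\<And>n. norm (x n) \<le> C"
    and weak: "\<And>u. (\<lambda>n. a (x n) u) \<longlonglongrightarrow> 0"
  shows "(\<lambda>n. \<iota> (x n)) \<longlonglongrightarrow> 0"
proof (rule ccontr)
  assume "\<not> (\<lambda>n. \<iota> (x n)) \<longlonglongrightarrow> 0"
  then obtain e where "e > 0" and e: "\<not> (\<forall>\<^sub>F n in sequentially. norm (\<iota> (x n)) < e)"
    by (auto simp: tendsto_iff)
  obtain r :: "nat \<Rightarrow> nat" where r: "strict_mono r" "\<And>n. \<not> norm (\<iota> (x (r n))) < e"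
    using not_eventually_sequentiallyD[OF e] by blast
  have "bounded (range x)" using bdd by (auto simp: bounded_iff)
  moreover have "range x \<subseteq> V" using V by blast
  ultimately have "compact (closure (\<iota> ` range x))"
    using compact unfolding compact_map_on_def by blast
  moreover have "\<iota> (x (r n)) \<in> closure (\<iota> ` range x)" for n
    by (intro subsetD[OF closure_subset] imageI rangeI)
  ultimately obtain f s where s: "strict_mono s" and "((\<lambda>n. \<iota> (x (r n))) \<circ> s) \<longlonglongrightarrow> f"
    unfolding compact_def by meson
  then have f: "(\<lambda>n. \<iota> (x (r (s n)))) \<longlonglongrightarrow> f" by (simp add: o_def)
  have weak': "(\<lambda>n. a (x (r (s n))) u) \<longlonglongrightarrow> 0" for u
    using LIMSEQ_subseq_LIMSEQ[OF weak strict_mono_o[OF r(1) s]] by (simp add: o_def)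
  \<comment> \<open>The representing vector in X. It lies in V because each
    \<open>\<iota> (x k)\<close> is orthogonal to \<open>\<iota> w\<close> for \<open>w\<close> in
    W, and this passes to the limit \<open>f\<close>.\<close>
  obtain g where g: "\<And>y. inner f (\<iota> y) = inner g y"
    using Riesz_representation_exists[OF bounded_linear_compose[OF bounded_linear_inner_right bl]]
    by metis
  have "g \<in> V"
    unfolding kernel_complement_iff
  proof (intro conjI ballI UNIV_I)
    fix w assume w: "w \<in> W"
    have "inner (\<iota> (x k)) (\<iota> w) = 0" for k
      using V_W_orth[OF V w, of k] w sym[of "x k" w] by (simp add: inner_eq form_kernel_iff)
    then have "(\<lambda>n. 0) \<longlonglongrightarrow> inner f (\<iota> w)"
      using tendsto_inner[OF f tendsto_const[of "\<iota> w"]] by simp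
    then show "inner g w = 0" using g LIMSEQ_unique[OF tendsto_const] by metis
  qed
  have g': "inner (\<iota> y) (\<iota> g) + a y g = inner f (\<iota> y)" for y
    using inner_eq[of y g] by (simp add: g inner_commute)
  have "(\<lambda>n. inner (\<iota> (x (r (s n)))) (\<iota> g) + a (x (r (s n))) g) \<longlonglongrightarrow> inner f (\<iota> g) + 0"
    by (intro tendsto_add tendsto_inner f tendsto_const weak')
  then have "(\<lambda>n. inner f (\<iota> (x (r (s n))))) \<longlonglongrightarrow> inner f (\<iota> g)"
    unfolding g' by (simp add: inner_commute)
  then have ff: "inner f f = inner f (\<iota> g)"
    using LIMSEQ_unique tendsto_inner[OF tendsto_const f] by blast
  have ag: "inner f (\<iota> g) = inner (\<iota> g) (\<iota> g) + a g g"
    by (simp add: g inner_eq)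
  \<comment> \<open>A square equal to \<open>- a g g\<close> forces the energy of \<open>g\<close>
    to vanish.\<close>
  have "inner (f - \<iota> g) (f - \<iota> g) = - a g g"
    using ff ag by (simp add: inner_diff_left inner_diff_right inner_commute)
  then have "a g g = 0" using psd[of g] inner_ge_zero[of "f - \<iota> g"] by linarith
  then have "g \<in> W" using Cauchy_Schwarz[of g] by (simp add: form_kernel_iff)
  with \<open>g \<in> V\<close> have "g = 0" by (rule V_Int_W)
  then have "f = 0" using ff by (simp add: iota.zero)
  then have "\<forall>\<^sub>F n in sequentially. norm (\<iota> (x (r (s n)))) < e"
    using f \<open>e > 0\<close> by (auto simp: tendsto_iff)
  then show False using r(2) by (auto simp: eventually_sequentially)
qed

text \<open>On V the energy controls the full norm. Otherwise normalised vectors with energy tending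
  to 0 would, by Cauchy-Schwarz, be weakly null for \<open>a\<close>, hence null in the ambient
  space, and their norms in X would tend to 0.\<close>

lemma Poincare:
  assumes compact: "compact_map_on V \<iota>"
  shows "\<exists>C. \<forall>v\<in>V. (norm v)\<^sup>2 \<le> C * a v v"
proof (rule ccontr)
  assume "\<nexists>C. \<forall>v\<in>V. (norm v)\<^sup>2 \<le> C * a v v"
  then have "\<forall>n. \<exists>v\<in>V. (norm v)\<^sup>2 > real (Suc n) * a v v" by (meson not_le)
  then obtain v where v: "\<And>n. v n \<in> V" "\<And>n. (norm (v n))\<^sup>2 > real (Suc n) * a (v n) (v n)"
    by metis
  have nz: "norm (v n) > 0" for n using v(2)[of n] by (auto simp: form.zero_left)
  define x where "x n = (1 / norm (v n)) *\<^sub>R v n" for n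
  have xV: "x n \<in> V" for n unfolding x_def by (intro subspace_scale subspace_V v(1))
  have nx: "norm (x n) = 1" for n using nz[of n] by (simp add: x_def)
  have ax: "a (x n) (x n) \<le> inverse (real (Suc n))" for n
  proof -
    have "a (v n) (v n) = a (x n) (x n) * (norm (v n))\<^sup>2"
      using nz[of n] by (simp add: x_def form.scaleR_left form.scaleR_right power2_eq_square)
    then have "(real (Suc n) * a (x n) (x n)) * (norm (v n))\<^sup>2 < 1 * (norm (v n))\<^sup>2"
      using v(2)[of n] by simp
    then have "real (Suc n) * a (x n) (x n) < 1"
      by (rule mult_right_less_imp_less) simp
    then show ?thesis by (simp add: field_simps)
  qed
  have lim: "(\<lambda>n. a (x n) (x n)) \<longlonglongrightarrow> 0"
    by (rule tendsto_sandwich[OF always_eventually always_eventually tendsto_const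
          LIMSEQ_inverse_real_of_nat])
      (simp_all only: psd ax simp_thms)
  have "(\<lambda>n. a (x n) u) \<longlonglongrightarrow> 0" for u
  proof -
    have "(\<lambda>n. (a (x n) u)\<^sup>2) \<longlonglongrightarrow> 0"
      by (rule tendsto_sandwich[OF always_eventually always_eventually tendsto_const
            tendsto_mult_left_zero[OF lim, of "a u u"]])
        (simp_all add: Cauchy_Schwarz)
    then show ?thesis by simp
  qed
  then have "(\<lambda>n. \<iota> (x n)) \<longlonglongrightarrow> 0"
    by (rule weakly_null_imp_null[OF compact xV eq_refl[OF nx]])
  then have "(\<lambda>n. (norm (\<iota> (x n)))\<^sup>2 + a (x n) (x n)) \<longlonglongrightarrow> 0\<^sup>2 + 0"
    by (intro tendsto_add tendsto_power tendsto_norm_zero lim)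
  then show False using nx by (simp add: norm_sq[symmetric] LIMSEQ_const_iff)
qed

section \<open>The projectors\<close>

context
  fixes S :: "'x set"
  assumes S: "subspace S" and fd: "finite_dimensional S"
begin

text \<open>Subtracting from an \<open>a\<close>-projection onto \<open>S\<close> its X-orthogonal
  component in the kernel moves it into the complement and changes no value of
  \<open>a\<close>.\<close>

lemma form_projector_exists:
  "\<exists>P. bounded_linear P \<and> (\<forall>u. P u \<in> kernel_complement \<iota> a S
        \<and> (\<forall>v\<in>S. a (P u) v = a u v))"
proof -
  obtain B where B: "finite B" "S = span B"
    using finite_dimensional_subspace_eq_span[OF S fd] .
  obtain R where R: "bounded_linear R" "\<And>u. R u \<in> S" "\<And>u v. v \<in> S \<Longrightarrow> a (R u) v = a u v"
    using psd_form_projection_exists[OF bil sym psd B(1)] B(2) by metis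
  have "finite_dimensional (form_kernel a S)"
    using fd by (auto simp: finite_dimensional_def form_kernel_def)
  then obtain D where D: "finite D" "form_kernel a S = span D"
    using finite_dimensional_subspace_eq_span[OF subspace_form_kernel[OF S]] by metis
  obtain K where K: "bounded_linear K" "\<And>u. K u \<in> form_kernel a S"
    "\<And>u v. v \<in> form_kernel a S \<Longrightarrow> inner (K u) v = inner u v"
    using psd_form_projection_exists[OF bounded_bilinear_inner inner_commute inner_ge_zero D(1)]
      D(2) by metis
  define P where "P u = R u - K (R u)" for u
  have "bounded_linear P"
    unfolding P_def by (intro bounded_linear_sub R(1) bounded_linear_compose[OF K(1) R(1)])
  moreover have "P u \<in> kernel_complement \<iota> a S" for u
    using K(2)[of "R u"] R(2)[of u] S K(3)
    by (auto simp: kernel_complement_iff P_def inner_diff_left form_kernel_iff intro: subspace_diff)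
  moreover have "a (P u) v = a u v" if "v \<in> S" for u v
    using K(2)[of "R u"] R(3)[OF that] by (simp add: P_def form.diff_left form_kernel_iff)
  ultimately show ?thesis by blast
qed

lemma form_projector_unique:
  assumes p: "p \<in> kernel_complement \<iota> a S" "\<And>v. v \<in> kernel_complement \<iota> a S \<Longrightarrow> a p v = a u v"
    and q: "q \<in> kernel_complement \<iota> a S" "\<And>v. v \<in> kernel_complement \<iota> a S \<Longrightarrow> a q v = a u v"
  shows "p = q"
proof -
  have d: "p - q \<in> kernel_complement \<iota> a S"
    using p(1) q(1) S by (auto simp: kernel_complement_iff inner_diff_left intro: subspace_diff)
  then have "a (p - q) (p - q) = 0" using p(2) q(2) by (simp add: form.diff_left)
  then have "p - q \<in> form_kernel a S"
    using d Cauchy_Schwarz[of "p - q"] by (simp add: form_kernel_iff kernel_complement_iff)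
  then have "inner (p - q) (p - q) = 0" using d by (simp add: kernel_complement_iff)
  then show ?thesis by simp
qed

lemma form_projector_eqI:
  assumes "p \<in> kernel_complement \<iota> a S" "\<And>v. v \<in> kernel_complement \<iota> a S \<Longrightarrow> a p v = a u v"
  shows "form_projector \<iota> a S u = p"
  unfolding form_projector_def
  by (rule the_equality) (use form_projector_unique[of _ u p] assms in \<open>blast+\<close>)

text \<open>The definition tests only against the complement of the kernel in \<open>S\<close>. The
  equation extends to all of \<open>S\<close>, which is the Galerkin orthogonality used
  below.\<close>

lemma
  bounded_linear_form_projector: "bounded_linear (form_projector \<iota> a S)" and
  form_projector_in: "form_projector \<iota> a S u \<in> kernel_complement \<iota> a S" and
  form_projector_form: "v \<in> S \<Longrightarrow> a (form_projector \<iota> a S u) v = a u v"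
proof -
  obtain P where P: "bounded_linear P" "\<And>u. P u \<in> kernel_complement \<iota> a S"
     "\<And>u v. v \<in> S \<Longrightarrow> a (P u) v = a u v"
    using form_projector_exists by blast
  have eq: "form_projector \<iota> a S = P"
    using P(2,3) by (intro ext form_projector_eqI) (auto simp: kernel_complement_iff)
  show "bounded_linear (form_projector \<iota> a S)"
    "form_projector \<iota> a S u \<in> kernel_complement \<iota> a S"
    "v \<in> S \<Longrightarrow> a (form_projector \<iota> a S u) v = a u v"
    unfolding eq by (fact P)+
qed

text \<open>Pythagoras for \<open>a\<close>: the error is \<open>a\<close>-orthogonal to the
  projection, so the energy of \<open>u\<close> is the sum of their energies.\<close>

lemma form_projector_form_le: "a (form_projector \<iota> a S u) (form_projector \<iota> a S u) \<le> a u u"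
  and form_projector_error_form_le:
    "a (u - form_projector \<iota> a S u) (u - form_projector \<iota> a S u) \<le> a u u"
proof -
  let ?p = "form_projector \<iota> a S u"
  have "?p \<in> S" using form_projector_in[of u] by (simp add: kernel_complement_iff)
  then have "a ?p ?p = a u ?p" by (rule form_projector_form)
  then have "a (u - ?p) (u - ?p) = a u u - a ?p ?p"
    by (simp add: form.diff_left form.diff_right sym[of ?p u])
  then show "a ?p ?p \<le> a u u" "a (u - ?p) (u - ?p) \<le> a u u"
    using psd[of "u - ?p"] psd[of ?p] by linarith+
qed

lemma compatible_form_projector: "compatible_operator a S (form_projector \<iota> a S)"
  unfolding compatible_operator_def
proof (intro conjI ballI)
  show "linear (form_projector \<iota> a S)"
    by (rule bounded_linear.linear[OF bounded_linear_form_projector])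
  show "range (form_projector \<iota> a S) \<subseteq> S"
    using form_projector_in by (auto simp: kernel_complement_iff)
  show "form_projector \<iota> a S ` W \<subseteq> form_kernel a S"
  proof clarify
    fix w assume "w \<in> W"
    then show "form_projector \<iota> a S w \<in> form_kernel a S"
      using form_projector_in[of w] form_projector_form[of _ w]
      by (auto simp: form_kernel_def kernel_complement_iff)
  qed
  fix u assume u: "u \<in> S"
  show "u - form_projector \<iota> a S u \<in> form_kernel a S"
    using form_projector_in[of u] form_projector_form[of _ u] u S
    by (auto simp: form_kernel_def kernel_complement_iff form.diff_left intro: subspace_diff)
qed

end

section \<open>Vanishing gap versus compatible operators\<close>

text \<open>The two kernel clauses of compatibility put \<open>u - Q (vpart u)\<close> into W_n. It
  is orthogonal to \<open>u\<close>, which lies in V_n, and to \<open>vpart u\<close>, because W_n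
  is contained in W; hence also to \<open>wpart u\<close>.\<close>

lemma norm_wpart_le_compatible_error:
  assumes S: "subspace S" and Q: "compatible_operator a S Q"
    and u: "u \<in> kernel_complement \<iota> a S"
  shows "norm (wpart u) \<le> norm (\<iota> (vpart u) - \<iota> (Q (vpart u)))"
proof -
  have lin: "linear Q" and Qw: "Q (wpart u) \<in> form_kernel a S"
    and Qu: "u - Q u \<in> form_kernel a S"
    using Q u wpart by (auto simp: compatible_operator_def kernel_complement_iff)
  define z where "z = u - Q (vpart u)"
  have "Q (vpart u) = Q u - Q (wpart u)" by (simp add: vpart_def linear_diff[OF lin])
  then have "z = (u - Q u) + Q (wpart u)" by (simp add: z_def)
  then have z: "z \<in> form_kernel a S"
    using subspace_add[OF subspace_form_kernel[OF S] Qu Qw] by simp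
  have "inner u z = 0" "inner (vpart u) z = 0"
    using u z V_W_orth[OF vpart] by (auto simp: kernel_complement_iff form_kernel_iff)
  then have wz: "inner (wpart u) z = 0" by (simp add: vpart_def inner_diff_left)
  have "wpart u = z - (vpart u - Q (vpart u))" by (simp add: z_def vpart_def)
  then have "inner (wpart u) (wpart u) = - inner (wpart u) (vpart u - Q (vpart u))"
    using wz by (metis inner_diff_right diff_0)
  \<comment> \<open>As \<open>a\<close> vanishes against \<open>wpart u\<close>, the error enters
    only through its ambient norm, the one that \<open>ANCO\<close> controls.\<close>
  also have "\<dots> = - inner (\<iota> (wpart u)) (\<iota> (vpart u - Q (vpart u)))"
    using wpart[of u] by (simp add: inner_eq form_kernel_iff)
  also have "\<dots> \<le> norm (\<iota> (wpart u)) * norm (\<iota> (vpart u - Q (vpart u)))"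
    using Cauchy_Schwarz_ineq2[of "\<iota> (wpart u)" "\<iota> (vpart u - Q (vpart u))"] by linarith
  also have "\<dots> = norm (wpart u) * norm (\<iota> (vpart u) - \<iota> (Q (vpart u)))"
    by (simp add: norm_iota_kernel[OF wpart] iota.diff)
  finally have "norm (wpart u) * norm (wpart u)
      \<le> norm (wpart u) * norm (\<iota> (vpart u) - \<iota> (Q (vpart u)))"
    by (simp add: power2_norm_eq_inner[symmetric] power2_eq_square)
  then show ?thesis by (cases "wpart u = 0") auto
qed

lemma ANCO_imp_gap_tendsto_0:
  assumes sub: "\<And>n. subspace (Xn n)" and "ANCO \<iota> a Xn Q"
  shows "(\<lambda>n. gap (kernel_complement \<iota> a (Xn n)) V) \<longlonglongrightarrow> 0"
proof -
  obtain \<epsilon> where Q: "\<And>n. compatible_operator a (Xn n) (Q n)" and \<epsilon>: "\<epsilon> \<longlonglongrightarrow> 0"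
    "\<And>n v. v \<in> V \<Longrightarrow> norm (\<iota> v - \<iota> (Q n v)) \<le> \<epsilon> n * norm v"
    using assms(2) by (auto simp: ANCO_def)
  \<comment> \<open>The absolute value is there because \<open>ANCO\<close> puts no sign on
    \<open>\<epsilon>\<close>, while \<open>gap_le\<close> asks for a nonnegative bound.\<close>
  have le: "gap (kernel_complement \<iota> a (Xn n)) V \<le> \<bar>\<epsilon> n\<bar>" for n
  proof (rule gap_le)
    fix u assume u: "u \<in> kernel_complement \<iota> a (Xn n)"
    have "norm (wpart u) \<le> \<epsilon> n * norm (vpart u)"
      using norm_wpart_le_compatible_error[OF sub Q u] \<epsilon>(2)[OF vpart] by (meson order_trans)
    also have "\<dots> \<le> \<bar>\<epsilon> n\<bar> * norm u" by (intro mult_mono norm_vpart_le) auto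
    finally show "norm (wpart u) \<le> \<bar>\<epsilon> n\<bar> * norm u" .
  qed simp
  show ?thesis
    by (rule tendsto_sandwich[OF always_eventually always_eventually tendsto_const
          tendsto_rabs_zero[OF \<epsilon>(1)]])
      (simp_all only: gap_nonneg le simp_thms)
qed

lemma gap_tendsto_0_imp_ANCO:
  assumes compact: "compact_map_on V \<iota>"
    and sub: "\<And>n. subspace (Xn n)" and fd: "\<And>n. finite_dimensional (Xn n)"
    and AS: "\<And>u. (\<lambda>n. INF u' \<in> Xn n. norm (u - u')) \<longlonglongrightarrow> 0"
    and VG: "(\<lambda>n. gap (kernel_complement \<iota> a (Xn n)) V) \<longlonglongrightarrow> 0"
  shows "ANCO \<iota> a Xn (\<lambda>n. form_projector \<iota> a (Xn n))"
proof -
  let ?P = "\<lambda>n. form_projector \<iota> a (Xn n)"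
  let ?\<delta> = "\<lambda>n. gap (kernel_complement \<iota> a (Xn n)) V"
  obtain C where C: "\<And>v. v \<in> V \<Longrightarrow> (norm v)\<^sup>2 \<le> C * a v v"
    using Poincare[OF compact] by blast
  \<comment> \<open>\<open>C\<close> comes without a sign. \<open>M\<close> bounds the X-norm of
    every vector of V with energy at most 1.\<close>
  define M where "M = sqrt \<bar>C\<bar>"
  have V_bound: "norm v \<le> M" if "v \<in> V" "a v v \<le> 1" for v
  proof -
    have "(norm v)\<^sup>2 \<le> \<bar>C\<bar> * 1"
      using C[OF that(1)] mult_mono[OF abs_ge_self[of C] that(2) _ psd] by simp
    then show ?thesis using real_le_rsqrt by (simp add: M_def)
  qed
  \<comment> \<open>Composing with \<open>vpart\<close> extends the error operator from V to all of
    X and keeps its values on V, so that \<open>onorm_tendsto_0\<close> applies.\<close>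
  define T where "T n x = \<iota> (vpart x - ?P n (vpart x))" for n x
  have blT: "bounded_linear (T n)" for n
    unfolding T_def
    by (intro bounded_linear_compose[OF bl] bounded_linear_sub bounded_linear_vpart
        bounded_linear_compose[OF bounded_linear_form_projector[OF sub fd]])
  have null: "(\<lambda>n. T n (x n)) \<longlonglongrightarrow> 0" if x: "\<And>n. norm (x n) \<le> 1" for x
  proof -
    define v where "v n = vpart (x n)" for n
    define p where "p n = ?P n (v n)" for n
    define e where "e n = v n - p n" for n
    have vV: "v n \<in> V" for n by (simp add: v_def vpart)
    have av: "a (v n) (v n) \<le> 1" for n
    proof -
      have "(norm (v n))\<^sup>2 \<le> 1"
        using order_trans[OF norm_vpart_le x] by (simp add: v_def power_le_one)
      then show ?thesis using norm_sq[of "v n"] by (smt (verit) zero_le_power2)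
    qed
    have ap: "a (p n) (p n) \<le> 1" for n
      using form_projector_form_le[OF sub fd, of n "v n"] av[of n] by (simp add: p_def)
    have ae: "a (e n) (e n) \<le> 1" for n
      using form_projector_error_form_le[OF sub fd, of "v n" n] av[of n] by (simp add: p_def e_def)
    have "(\<lambda>n. a (vpart (e n)) u) \<longlonglongrightarrow> 0" for u
    proof -
      \<comment> \<open>By Galerkin orthogonality any \<open>u'\<close> of \<open>Xn n\<close> may
        be subtracted from \<open>u\<close>, so the pairing is bounded by the infimum in AS.\<close>
      have "\<bar>a (vpart (e n)) u\<bar> \<le> (INF u' \<in> Xn n. norm (u - u'))" for n
      proof (rule cINF_greatest)
        show "Xn n \<noteq> {}" using subspace_0[OF sub] by blast
        fix u' assume u': "u' \<in> Xn n"
        have "a (e n) u' = 0"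
          using form_projector_form[OF sub fd u'] by (simp add: e_def p_def form.diff_left)
        then have "a (vpart (e n)) u = a (e n) (u - u')"
          by (simp add: form_vpart form.diff_right)
        also have "\<bar>a (e n) (u - u')\<bar> \<le> norm (u - u')"
        proof (rule power2_le_imp_le)
          have "(a (e n) (u - u'))\<^sup>2 \<le> 1 * (norm (u - u'))\<^sup>2"
            using Cauchy_Schwarz[of "e n" "u - u'"] norm_sq[of "u - u'"]
            by (intro order_trans[OF _ mult_mono[OF ae]]) (auto simp: psd)
          then show "\<bar>a (e n) (u - u')\<bar>\<^sup>2 \<le> (norm (u - u'))\<^sup>2" by simp
        qed simp
        finally show "\<bar>a (vpart (e n)) u\<bar> \<le> norm (u - u')" .
      qed
      then show ?thesis
        by (intro Lim_null_comparison[OF _ AS[of u]] always_eventually allI) simp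
    qed
    moreover have "norm (vpart (e n)) \<le> M" for n
      using ae by (intro V_bound vpart) (simp add: form_vpart_vpart)
    ultimately have V_part: "(\<lambda>n. \<iota> (vpart (e n))) \<longlonglongrightarrow> 0"
      by (intro weakly_null_imp_null[OF compact vpart])
    \<comment> \<open>No bound on \<open>norm (p n)\<close> is known beforehand, only one on its
      V-part. The W-part therefore stands on both sides and is absorbed once the gap is below
      1/2.\<close>
    have w_bound: "(1 - ?\<delta> n) * norm (wpart (p n)) \<le> ?\<delta> n * M" for n
    proof -
      have "p n \<in> kernel_complement \<iota> a (Xn n)"
        by (simp add: p_def form_projector_in[OF sub fd])
      then have "norm (wpart (p n)) \<le> ?\<delta> n * norm (p n)" by (rule norm_wpart_le_gap)
      also have "\<dots> \<le> ?\<delta> n * (M + norm (wpart (p n)))"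
      proof (rule mult_left_mono[OF _ gap_nonneg])
        have "norm (vpart (p n)) \<le> M"
          using ap by (intro V_bound vpart) (simp add: form_vpart_vpart)
        then show "norm (p n) \<le> M + norm (wpart (p n))"
          using norm_triangle_ineq[of "vpart (p n)" "wpart (p n)"] by (simp add: split)
      qed
      finally show ?thesis by (simp add: algebra_simps)
    qed
    have "\<forall>\<^sub>F n in sequentially. norm (wpart (p n)) \<le> 2 * (?\<delta> n * M)"
    proof (rule eventually_mono)
      show "\<forall>\<^sub>F n in sequentially. ?\<delta> n < 1 / 2" by (rule order_tendstoD(2)[OF VG]) simp
      fix n assume "?\<delta> n < 1 / 2"
      then have "1 / 2 * norm (wpart (p n)) \<le> (1 - ?\<delta> n) * norm (wpart (p n))"
        by (intro mult_right_mono) auto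
      then show "norm (wpart (p n)) \<le> 2 * (?\<delta> n * M)" using w_bound[of n] by linarith
    qed
    moreover have "(\<lambda>n. 2 * (?\<delta> n * M)) \<longlonglongrightarrow> 0"
      using tendsto_mult_right_zero[OF tendsto_mult_left_zero[OF VG]] .
    ultimately have w_lim: "(\<lambda>n. wpart (p n)) \<longlonglongrightarrow> 0" by (rule Lim_null_comparison)
    \<comment> \<open>\<open>v n\<close> has no W-part, so the W-part of \<open>e n\<close> is that
      of \<open>- p n\<close>.\<close>
    have "T n (x n) = \<iota> (vpart (e n)) - \<iota> (wpart (p n))" for n
    proof -
      have "vpart (e n) = v n - vpart (p n)"
        using bounded_linear.linear[OF bounded_linear_vpart]
        by (simp add: e_def linear_diff vpart_V[OF vV])
      then have "e n = vpart (e n) - wpart (p n)" by (simp add: e_def vpart_def)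
      moreover have "T n (x n) = \<iota> (e n)" by (simp add: T_def e_def p_def v_def)
      ultimately show ?thesis by (metis iota.diff)
    qed
    then show ?thesis
      using tendsto_diff[OF V_part iota.tendsto_zero[OF w_lim]] by simp
  qed
  have "norm (\<iota> v - \<iota> (?P n v)) \<le> onorm (T n) * norm v" if "v \<in> V" for n v
    using onorm[OF blT, of n v] by (simp add: T_def vpart_V[OF that] iota.diff)
  then show ?thesis
    unfolding ANCO_def
    using compatible_form_projector[OF sub fd] onorm_tendsto_0[OF blT null] by blast
qed

end

theorem proposition16:
  fixes \<iota> :: "'x::{real_inner, complete_space} \<Rightarrow> 'o::{real_inner, complete_space}"
    and a :: "'x \<Rightarrow> 'x \<Rightarrow> real"
    and Xn :: "nat \<Rightarrow> 'x set"
  assumes "separable_space (euclidean :: 'o topology)"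
    and "\<not> finite_dimensional (UNIV :: 'o set)"
    and "bounded_linear \<iota>" and "inj \<iota>" and "closure (range \<iota>) = UNIV"
    and "bounded_bilinear a"
    and "\<And>u v. a u v = a v u"
    and "\<And>u. a u u \<ge> 0"
    and "\<And>u v. inner u v = inner (\<iota> u) (\<iota> v) + a u v"
    and "compact_map_on (kernel_complement \<iota> a UNIV) \<iota>"
    and "\<And>n. subspace (Xn n)"
    and "\<And>n. finite_dimensional (Xn n)"
    and "\<And>u. (\<lambda>n. INF u' \<in> Xn n. norm (u - u')) \<longlonglongrightarrow> 0"
  shows "((\<lambda>n. gap (kernel_complement \<iota> a (Xn n)) (kernel_complement \<iota> a UNIV)) \<longlonglongrightarrow> 0
            \<longleftrightarrow> ANCO \<iota> a Xn (\<lambda>n. form_projector \<iota> a (Xn n)))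
       \<and> (ANCO \<iota> a Xn (\<lambda>n. form_projector \<iota> a (Xn n)) \<longleftrightarrow> (\<exists>Q. ANCO \<iota> a Xn Q))"
proof -
  interpret form_space \<iota> a
    by (rule form_space.intro) (fact assms)+
  \<comment> \<open>A cycle: vanishing gap makes the projectors ANCO, they witness existence, and
    any ANCO make the gap vanish.\<close>
  show ?thesis
    using gap_tendsto_0_imp_ANCO[OF assms(10-13)] ANCO_imp_gap_tendsto_0[of Xn, OF assms(11)] by blast
qed

end
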